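(* Let $\mathcal{C}\subseteq 2^{[n]}$ be a code and let $d\ge 1$. Then $\mathcal{C}$ is box-convex in $\mathbb{R}^d$ if and only if $\mathcal{C}$ is the intersection product of $d$-many interval codes, i.e. there exist interval codes $\mathcal{C}_1,\ldots,\mathcal{C}_d\subseteq 2^{[n]}$ with $\mathcal{C}=\mathcal{C}_1\sqcap\cdots\sqcap\mathcal{C}_d$.
   Context: Write $[n]=\{1,\ldots,n\}$. A code is a set $\mathcal{C}\subseteq 2^{[n]}$. For an ordered (indexed) collection $\mathcal{U} = \{U_1, \ldots, U_n\}$ of sets in $\mathbb{R}^d$, its code is $$\operatorname{code}(\mathcal{U}) = \{\sigma\subseteq [n] \mid \text{there exists } p\in \mathbb{R}^d \text{ such that for all } i\in[n],\ p\in U_i \text{ if and only if } i\in\sigma\},$$ and $\mathcal{U}$ is called a realization of $\operatorname{code}(\mathcal{U})$. An axis-parallel box (box for short) in $\mathbb{R}^d$ is either the empty set or a product $[a_1,b_1]\times\cdots\times[a_d,b_d]$ of nonempty closed intervals (degenerate intervals $a_i=b_i$ allowed). A code is box-convex in $\mathbb{R}^d$ if it has a realization in $\mathbb{R}^d$ in which every set is a box. An interval code is a code with a realization in $\mathbb{R}^1$ in which every set is a closed bounded interval (i.e. a box in $\mathbb{R}^1$, so the empty set and single points are allowed). The intersection product of two codes $\mathcal{C},\mathcal{D}\subseteq 2^{[n]}$ is $\mathcal{C} \sqcap \mathcal{D} = \{ c_1 \cap c_2 \mid c_1\in \mathcal{C} \text{ and } c_2\in \mathcal{D}\}$; this operation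 is associative. *)

theory Defs
  imports "HOL-Analysis.Analysis"
begin

text \<open>A code on \<open>[n]\<close> is a set \<open>C \<subseteq> Pow {1..n}\<close>.
  Collections are indexed by \<open>nat\<close>; only the indices in \<open>{1..n}\<close> matter.\<close>

definition code_of :: "nat \<Rightarrow> (nat \<Rightarrow> 'a set) \<Rightarrow> nat set set" where
  "code_of n U = {\<sigma>. \<sigma> \<subseteq> {1..n} \<and> (\<exists>p. \<forall>i\<in>{1..n}. p \<in> U i \<longleftrightarrow> i \<in> \<sigma>)}"

definition axis_box :: "(real ^ 'd) set \<Rightarrow> bool" where
  "axis_box S \<longleftrightarrow>
     S = {} \<or> (\<exists>a b. (\<forall>j. a $ j \<le> b $ j) \<and> S = cbox a b)"

text \<open>The type argument carries the dimension: the ambient space is \<open>real ^ 'd\<close>, of dimension \<open>CARD('d)\<close>.\<close>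

definition box_convex :: "'d::finite itself \<Rightarrow> nat \<Rightarrow> nat set set \<Rightarrow> bool" where
  "box_convex _ n C \<longleftrightarrow>
     (\<exists>U :: nat \<Rightarrow> (real ^ 'd) set. (\<forall>i\<in>{1..n}. axis_box (U i)) \<and> code_of n U = C)"

text \<open>The interval \<open>{a..b}\<close> is empty for \<open>a > b\<close> and a single point for \<open>a = b\<close>; both are allowed.\<close>

definition interval_code :: "nat \<Rightarrow> nat set set \<Rightarrow> bool" where
  "interval_code n C \<longleftrightarrow>
     (\<exists>U :: nat \<Rightarrow> real set. (\<forall>i\<in>{1..n}. \<exists>a b. U i = {a..b}) \<and> code_of n U = C)"

definition inter_prod :: "nat set set \<Rightarrow> nat set set \<Rightarrow> nat set set"  (infixl \<open>\<sqinter>\<^sub>c\<close> 70) where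
  "C \<sqinter>\<^sub>c D = {c1 \<inter> c2 |c1 c2. c1 \<in> C \<and> c2 \<in> D}"

text \<open>The iterated product \<open>C\<^sub>1 \<sqinter>\<^sub>c \<dots> \<sqinter>\<^sub>c C\<^sub>d\<close> of a nonempty list; meaningless on \<open>[]\<close>.\<close>

definition inter_prod_list :: "nat set set list \<Rightarrow> nat set set" where
  "inter_prod_list Cs = foldl (\<sqinter>\<^sub>c) (hd Cs) (tl Cs)"

end

theory Submission
  imports Defs
begin

text \<open>A point lies in a box iff each of its coordinates lies in the corresponding factor, so the
  codeword of a point is the intersection of the codewords of its coordinates. As the coordinates of
  a point can be chosen independently, all intersections of codewords arise.\<close>

definition codeword :: "nat \<Rightarrow> (nat \<Rightarrow> 'a set) \<Rightarrow> 'a \<Rightarrow> nat set" where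
  "codeword n U p = {i \<in> {1..n}. p \<in> U i}"

lemma code_of_eq_range: "code_of n U = range (codeword n U)"
  unfolding code_of_def codeword_def by blast

lemma inter_prod_list_snoc:
  "Cs \<noteq> [] \<Longrightarrow> inter_prod_list (Cs @ [D]) = inter_prod_list Cs \<sqinter>\<^sub>c D"
  by (simp add: inter_prod_list_def)

text \<open>Distinct entries of \<open>xs\<close> can be assigned values independently, so
  separately chosen factors always come from one choice function \<open>p\<close>. A repeated entry
  would force equal values at both places.\<close>

lemma inter_prod_list_ranges:
  fixes t :: "'i \<Rightarrow> 'b \<Rightarrow> nat set"
  assumes "xs \<noteq> []" "distinct xs"
  shows "inter_prod_list (map (\<lambda>x. range (t x)) xs) = range (\<lambda>p. \<Inter>x\<in>set xs. t x (p x))"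
  using assms
proof (induction xs rule: rev_nonempty_induct)
  case (single x)
  \<comment> \<open>If \<open>c = t x q\<close>, the constant function with value \<open>q\<close>
    is a suitable choice function.\<close>
  have "c \<in> range (\<lambda>p. t x (p x))" if "c \<in> range (t x)" for c
    using that by (auto intro: range_eqI[where x = "\<lambda>_. _"])
  then show ?case
    by (auto simp: inter_prod_list_def)
next
  case (snoc x xs)
  let ?A = "\<lambda>p. \<Inter>y\<in>set xs. t y (p y)"
  have "range ?A \<sqinter>\<^sub>c range (t x) = range (\<lambda>p. ?A p \<inter> t x (p x))"
  proof
    show "range ?A \<sqinter>\<^sub>c range (t x) \<subseteq> range (\<lambda>p. ?A p \<inter> t x (p x))"
    proof
      fix c assume "c \<in> range ?A \<sqinter>\<^sub>c range (t x)"
      then obtain p q where c: "c = ?A p \<inter> t x q"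
        by (auto simp: inter_prod_def)
      \<comment> \<open>Distinctness puts \<open>x\<close> outside \<open>set xs\<close>, so
        overwriting \<open>p\<close> at \<open>x\<close> leaves the earlier factors alone and merges
        \<open>p\<close> and \<open>q\<close> into one function.\<close>
      have "?A (p(x := q)) = ?A p"
        using snoc.prems by (intro INF_cong) auto
      then have "c = ?A (p(x := q)) \<inter> t x ((p(x := q)) x)"
        by (simp add: c)
      then show "c \<in> range (\<lambda>p. ?A p \<inter> t x (p x))"
        by blast
    qed
  qed (auto simp: inter_prod_def)
  with snoc show ?case
    by (simp add: inter_prod_list_snoc Int_commute)
qed

text \<open>The bridge used in both directions of the theorem, with intervals as factors. The list
  \<open>js\<close> enumerates the coordinates to give the factors an order.\<close>

lemma code_of_product:
  fixes I :: "'d::finite \<Rightarrow> nat \<Rightarrow> 'b set"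
  assumes "distinct js" "set js = (UNIV :: 'd set)"
  shows "code_of n (\<lambda>i. {p :: 'b ^ 'd. \<forall>j. p $ j \<in> I j i})
    = inter_prod_list (map (\<lambda>j. code_of n (I j)) js)" (is "code_of n ?U = _")
proof -
  have surj: "range (vec_lambda :: _ \<Rightarrow> 'b ^ 'd) = UNIV"
    by (rule surjI[of _ vec_nth]) (rule vec_nth_inverse)
  have "js \<noteq> []"
    using assms(2) by auto
  then have "inter_prod_list (map (\<lambda>j. code_of n (I j)) js)
      = range (\<lambda>p. \<Inter>j. codeword n (I j) (p j))"
    using assms by (simp add: code_of_eq_range inter_prod_list_ranges)
  also have "\<dots> = range (codeword n ?U \<circ> vec_lambda)"
    \<comment> \<open>As \<open>'d\<close> is nonempty, the intersection over \<open>j\<close> stays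
      inside \<open>{1..n}\<close>.\<close>
    by (intro arg_cong[of _ _ range] ext) (auto simp: codeword_def)
  also have "\<dots> = code_of n ?U"
    by (simp only: code_of_eq_range image_comp[symmetric] surj)
  finally show ?thesis by simp
qed

text \<open>Endpoints need no ordering here: a single reversed interval empties the whole product,
  which covers the empty box.\<close>

lemma axis_box_iff_product:
  fixes S :: "(real ^ 'd::finite) set"
  shows "axis_box S \<longleftrightarrow> (\<exists>a b. S = {p. \<forall>j. p $ j \<in> {a j..b j}})"
proof
  assume "axis_box S"
  then consider "S = {}" | a b where "S = cbox a b"
    by (auto simp: axis_box_def)
  then show "\<exists>a b. S = {p. \<forall>j. p $ j \<in> {a j..b j}}"
  proof cases
    case 1
    then have "S = {p. \<forall>j. p $ j \<in> {1..0}}"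
      by simp
    then show ?thesis
      by (intro exI[of _ "\<lambda>_. 1"] exI[of _ "\<lambda>_. 0"])
  next
    case 2
    then have "S = {p. \<forall>j. p $ j \<in> {a $ j..b $ j}}"
      by (auto simp: mem_box_cart)
    then show ?thesis
      by blast
  qed
next
  assume "\<exists>a b. S = {p. \<forall>j. p $ j \<in> {a j..b j}}"
  then obtain a b where S: "S = {p. \<forall>j. p $ j \<in> {a j..b j}}"
    by blast
  then have "S = cbox (vec_lambda a) (vec_lambda b)"
    by (auto simp: mem_box_cart)
  moreover have "S = {}" if "\<not> (\<forall>j. a j \<le> b j)"
    using that S by (auto intro: order_trans)
  ultimately show "axis_box S"
    by (metis axis_box_def vec_lambda_beta)
qed

lemma code_of_cong:
  "(\<And>i. i \<in> {1..n} \<Longrightarrow> U i = V i) \<Longrightarrow> code_of n U = code_of n V"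
  unfolding code_of_def by auto

theorem corollary5:
  fixes n :: nat and C :: "nat set set"
  assumes "C \<subseteq> Pow {1..n}"
  shows "box_convex TYPE('d::finite) n C \<longleftrightarrow>
    (\<exists>Cs. length Cs = CARD('d) \<and> (\<forall>D\<in>set Cs. D \<subseteq> Pow {1..n} \<and> interval_code n D) \<and>
          C = inter_prod_list Cs)"
proof -
  obtain js :: "'d list" where js: "set js = UNIV" "distinct js"
    using finite_distinct_list[OF finite] by blast
  then have len: "length js = CARD('d)"
    by (metis distinct_card)
  show ?thesis
  proof
    assume "box_convex TYPE('d) n C"
    then obtain U :: "nat \<Rightarrow> (real ^ 'd) set"
      where U: "\<And>i. i \<in> {1..n} \<Longrightarrow> axis_box (U i)" "code_of n U = C"
      unfolding box_convex_def by blast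
    have "\<forall>i\<in>{1..n}. \<exists>a b. U i = {p. \<forall>j. p $ j \<in> {a j..b j}}"
      using U(1) unfolding axis_box_iff_product by (rule ballI)
    then obtain a where "\<forall>i\<in>{1..n}. \<exists>b. U i = {p. \<forall>j. p $ j \<in> {a i j..b j}}"
      by (rule bchoice[THEN exE])
    then obtain b where "\<forall>i\<in>{1..n}. U i = {p. \<forall>j. p $ j \<in> {a i j..b i j}}"
      by (rule bchoice[THEN exE])
    then have ab: "U i = {p. \<forall>j. p $ j \<in> {a i j..b i j}}" if "i \<in> {1..n}" for i
      using that by (rule bspec)
    \<comment> \<open>Transposing the indices turns the factors of the boxes into one collection
      \<open>I j\<close> of intervals per coordinate.\<close>
    define I where "I j i = {a i j..b i j}" for j i
    have "C = code_of n (\<lambda>i. {p. \<forall>j. p $ j \<in> I j i})"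
      unfolding U(2)[symmetric] I_def using ab by (rule code_of_cong)
    then have "C = inter_prod_list (map (\<lambda>j. code_of n (I j)) js)"
      by (simp only: code_of_product[OF js(2,1)])
    moreover have "code_of n (I j) \<subseteq> Pow {1..n} \<and> interval_code n (code_of n (I j))" for j
    proof
      show "code_of n (I j) \<subseteq> Pow {1..n}"
        by (auto simp: code_of_def)
      show "interval_code n (code_of n (I j))"
        unfolding interval_code_def by (rule exI[of _ "I j"]) (auto simp: I_def)
    qed
    ultimately show "\<exists>Cs. length Cs = CARD('d) \<and>
        (\<forall>D\<in>set Cs. D \<subseteq> Pow {1..n} \<and> interval_code n D) \<and> C = inter_prod_list Cs"
      using len by (intro exI[of _ "map (\<lambda>j. code_of n (I j)) js"]) auto
  next
    assume "\<exists>Cs. length Cs = CARD('d) \<and>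
        (\<forall>D\<in>set Cs. D \<subseteq> Pow {1..n} \<and> interval_code n D) \<and> C = inter_prod_list Cs"
    then obtain Cs where Cs: "length Cs = CARD('d)" "\<forall>D\<in>set Cs. interval_code n D"
        "C = inter_prod_list Cs"
      by blast
    \<comment> \<open>Reindexes \<open>Cs\<close> by coordinates: the code at position
      \<open>k\<close> is attached to \<open>js ! k\<close>. The lookup succeeds because
      \<open>js\<close> lists every coordinate and has the length of \<open>Cs\<close>.\<close>
    define F where "F = (\<lambda>j. the (map_of (zip js Cs) j))"
    have Cs_F: "Cs = map F js"
      using js len Cs(1) by (intro nth_equalityI) (auto simp: F_def map_of_zip_nth)
    have "\<forall>j. interval_code n (F j)"
      using Cs(2) js(1) by (simp add: Cs_F)
    then have "\<exists>I :: 'd \<Rightarrow> nat \<Rightarrow> real set.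
        \<forall>j. (\<forall>i\<in>{1..n}. \<exists>a b. I j i = {a..b}) \<and> code_of n (I j) = F j"
      unfolding interval_code_def by (rule choice)
    then obtain I :: "'d \<Rightarrow> nat \<Rightarrow> real set"
      where "\<forall>j. (\<forall>i\<in>{1..n}. \<exists>a b. I j i = {a..b}) \<and> code_of n (I j) = F j"
      by (rule exE)
    then have I: "\<forall>i\<in>{1..n}. \<exists>a b. I j i = {a..b}" "code_of n (I j) = F j" for j
      by simp_all
    \<comment> \<open>The realizations of the codes \<open>F j\<close> may be chosen unrelated to
      each other; the box for \<open>i\<close> is the product of their \<open>i\<close>-th
      intervals.\<close>
    have "axis_box {p :: real ^ 'd. \<forall>j. p $ j \<in> I j i}" if i: "i \<in> {1..n}" for i
    proof -
      have "\<forall>j. \<exists>a b. I j i = {a..b}"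
        using I(1) i by simp
      then obtain a b where "\<And>j. I j i = {a j..b j}"
        by metis
      then show ?thesis
        unfolding axis_box_iff_product by (intro exI[of _ a] exI[of _ b]) simp
    qed
    moreover have "code_of n (\<lambda>i. {p. \<forall>j. p $ j \<in> I j i}) = C"
      by (simp only: code_of_product[OF js(2,1)] I(2) Cs(3) Cs_F)
    ultimately show "box_convex TYPE('d) n C"
      unfolding box_convex_def by (intro exI[of _ "\<lambda>i. {p. \<forall>j. p $ j \<in> I j i}"] conjI ballI)
  qed
qed

end
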